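(* Let $q\in(0,1)$, $\alpha,\beta>-1$, $n\in\mathbb N$, and let $f:(0,1)\to\mathbb R$ satisfy condition $C(\alpha)$. The number of sign changes of the polynomial $M_{n,q}^{\alpha,\beta}f$ on $(0,1)$ is not greater than the number of sign changes of the function $f$ on $(0,1)$.
   Context: For real $a$, $[a]_q=\frac{1-q^a}{1-q}$; $[n]_q!=\prod_{j=1}^n[j]_q$; $\begin{bmatrix}n\\k\end{bmatrix}_q=\frac{[n]_q!}{[k]_q!\,[n-k]_q!}$. For real $a$, $(1-x)_q^a=\prod_{j=0}^\infty\frac{1-q^jx}{1-q^{j+a}x}$. The Jackson integral is $\int_0^ah(t)\,d_qt=a(1-q)\sum_{i\ge0}q^ih(q^ia)$. Put $b_{n,k,q}(x)=\begin{bmatrix}n\\k\end{bmatrix}_qx^k(1-x)_q^{n-k}$, $0\le k\le n$. For $f:(0,1)\to\mathbb R$, $$M_{n,q}^{\alpha,\beta}f(x)=\sum_{k=0}^n f_{n,k,q}^{\alpha,\beta}\,b_{n,k,q}(x),\qquad f_{n,k,q}^{\alpha,\beta}=\frac{\int_0^1t^{k+\alpha}(1-qt)_q^{n-k+\beta}f(q^{\beta+1}t)\,d_qt}{\int_0^1t^{k+\alpha}(1-qt)_q^{n-k+\beta}\,d_qt}.$$ Condition $C(\alpha)$: there exist $\gamma\ge0$ with $\alpha>\gamma-1$ and $A\in(0,1]$ such that $x^\gamma f(x)$ is bounded on $(0,A]$ (for $A=1$, on $(0,1)$). Under this condition $M_{n,q}^{\alpha,\beta}f$ is well defined. The number of sign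 changes of a real function $h$ on $(0,1)$ is the supremum (in $\mathbb N\cup\{\infty\}$), over all finite sequences $0<x_1<\dots<x_m<1$, of the number of sign changes in $h(x_1),\dots,h(x_m)$, zero terms being discarded. *)

theory Defs
  imports "HOL-Analysis.Analysis" "HOL-Library.Extended_Nat"
begin

definition q_number :: "real \<Rightarrow> real \<Rightarrow> real" where
  "q_number q a = (1 - q powr a) / (1 - q)"

definition q_fact :: "real \<Rightarrow> nat \<Rightarrow> real" where
  "q_fact q n = (\<Prod>j=1..n. q_number q (real j))"

definition q_binomial :: "real \<Rightarrow> nat \<Rightarrow> nat \<Rightarrow> real" where
  "q_binomial q n k = q_fact q n / (q_fact q k * q_fact q (n - k))"

(* q_power q x a is (1 - x)_q^a; note that the argument is x, not 1 - x. *)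
definition q_power :: "real \<Rightarrow> real \<Rightarrow> real \<Rightarrow> real" where
  "q_power q x a = prodinf (\<lambda>j. (1 - q ^ j * x) / (1 - q powr (real j + a) * x))"

definition jackson_integral :: "real \<Rightarrow> real \<Rightarrow> (real \<Rightarrow> real) \<Rightarrow> real" where
  "jackson_integral q a h = a * (1 - q) * (\<Sum>i. q ^ i * h (q ^ i * a))"

definition q_bernstein :: "real \<Rightarrow> nat \<Rightarrow> nat \<Rightarrow> real \<Rightarrow> real" where
  "q_bernstein q n k x = q_binomial q n k * x ^ k * q_power q x (real (n - k))"

definition q_durrmeyer_coeff ::
  "real \<Rightarrow> real \<Rightarrow> real \<Rightarrow> nat \<Rightarrow> nat \<Rightarrow> (real \<Rightarrow> real) \<Rightarrow> real" where
  "q_durrmeyer_coeff q \<alpha> \<beta> n k f =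
     jackson_integral q 1
       (\<lambda>t. t powr (real k + \<alpha>) * q_power q (q * t) (real (n - k) + \<beta>) * f (q powr (\<beta> + 1) * t)) /
     jackson_integral q 1
       (\<lambda>t. t powr (real k + \<alpha>) * q_power q (q * t) (real (n - k) + \<beta>))"

(* A function on the open unit interval is represented by a total function on the reals.
   For 0 < q < 1 and \<beta> > -1, only the values f (q powr (\<beta> + 1 + i)), at points of the
   interval, enter the operator. *)
definition q_durrmeyer ::
  "real \<Rightarrow> real \<Rightarrow> real \<Rightarrow> nat \<Rightarrow> (real \<Rightarrow> real) \<Rightarrow> real \<Rightarrow> real" where
  "q_durrmeyer q \<alpha> \<beta> n f x =
     (\<Sum>k=0..n. q_durrmeyer_coeff q \<alpha> \<beta> n k f * q_bernstein q n k x)"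

(* The intersection with the open unit interval only matters for A = 1. *)
definition condition_C :: "real \<Rightarrow> (real \<Rightarrow> real) \<Rightarrow> bool" where
  "condition_C \<alpha> f \<longleftrightarrow>
     (\<exists>\<gamma> A. \<gamma> \<ge> 0 \<and> \<alpha> > \<gamma> - 1 \<and> 0 < A \<and> A \<le> 1 \<and>
        bounded ((\<lambda>x. x powr \<gamma> * f x) ` ({0<..A} \<inter> {0<..<1})))"

definition list_sign_changes :: "real list \<Rightarrow> nat" where
  "list_sign_changes ys =
     (let zs = filter (\<lambda>y. y \<noteq> 0) ys
      in card {i. Suc i < length zs \<and> zs ! i * zs ! Suc i < 0})"

definition sign_changes :: "(real \<Rightarrow> real) \<Rightarrow> enat" where
  "sign_changes h =
     (SUP xs \<in> {xs. sorted_wrt (<) xs \<and> set xs \<subseteq> {0<..<1}}. enat (list_sign_changes (map h xs)))"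

end

theory Submission imports Defs begin

text \<open>
  The operator is a composition of two maps, \<open>f \<mapsto> (c\<^sub>0, ..., c\<^sub>n)\<close> and \<open>(c\<^sub>0, ..., c\<^sub>n) \<mapsto> \<Sum> c\<^sub>k b\<^sub>k\<close>, and neither of
  them can create sign changes. Both have, up to positive factors, the same kernel
  \<open>\<phi>\<^sub>n\<^sub>,\<^sub>k(x) = x\<^sup>k (1 - x)(1 - q x) ... (1 - q\<^bsup>n-k-1\<^esup> x)\<close>: for the second map this is the definition of the
  q-Bernstein polynomials, and for the first it appears when the Jackson integral is written as a sum
  over the nodes \<open>y\<^sub>i = q\<^bsup>\<beta>+1+i\<^esup>\<close> at which \<open>f\<close> is evaluated (\<open>jackson_integral_eq_moment\<close>).

  Both rules of signs rest on one identity (\<open>q_kernel_factor\<close>):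
  \<open>(1 - z q\<^bsup>n-k\<^esup>) \<phi>\<^sub>n\<^sub>+\<^sub>1\<^sub>,\<^sub>k\<^sub>+\<^sub>1(x) - z \<phi>\<^sub>n\<^sub>+\<^sub>1\<^sub>,\<^sub>k(x) = (x - z) \<phi>\<^sub>n\<^sub>,\<^sub>k(x)\<close>.
  Multiplication by \<open>x - z\<close> with \<open>0 < z < 1\<close> thus acts on coefficients, and on moments, as a difference
  operator with positive weights, which changes the number of sign changes in a controlled way.

  For the second map (\<open>alternates_coefficients\<close>), suppose \<open>p = \<Sum> c\<^sub>k \<phi>\<^sub>n\<^sub>,\<^sub>k\<close> has a sign change. Then \<open>p\<close> has a root \<open>z\<close>
  there and \<open>p = (x - z) r\<close>, where \<open>r\<close> retains all other sign changes of \<open>p\<close>, and the coefficients of \<open>r\<close> have fewer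
  sign changes than those of \<open>p\<close> (\<open>alternates_of_factor_extension\<close>). Induction on the number of sign
  changes gives Descartes' rule.

  For the first map (\<open>alternates_moments\<close>), place \<open>z\<close> at the first sign change of the sequence
  \<open>v\<^sub>i = w\<^sub>i f(y\<^sub>i)\<close>, where the weights \<open>w\<^sub>i\<close> are positive. The sequence \<open>v\<^sub>i (y\<^sub>i - z)\<close> has lost that change, while its
  moments \<open>\<Sum>\<^sub>i v\<^sub>i (y\<^sub>i - z) \<phi>\<^sub>n\<^sub>-\<^sub>1\<^sub>,\<^sub>k(y\<^sub>i)\<close> are weighted differences of the moments of \<open>v\<close>. A discrete Rolle theorem
  (\<open>alternates_of_difference\<close>) says that they have lost at most one change, and induction applies again.
  Condition C makes the sums that involve \<open>f\<close> converge absolutely.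
\<close>

section \<open>Alternations\<close>

text \<open>
  Here \<open>m\<close> counts sign changes, so \<open>m + 1\<close> points are involved and \<open>m = 0\<close> still demands a nonzero value.
  Otherwise the zero function would have to be excluded wherever a sign change is gained or lost.
  The scalar \<open>\<sigma>\<close> carries the sign of the first value; fixing the pattern \<open>\<sigma> (-1)\<^sup>i\<close>, rather than the
  signs of consecutive products, makes prepending a point and passing to \<open>-h\<close> mere changes of \<open>\<sigma>\<close>.
\<close>

definition alternating_at :: "('a::linorder \<Rightarrow> real) \<Rightarrow> (nat \<Rightarrow> 'a) \<Rightarrow> real \<Rightarrow> nat \<Rightarrow> bool" where
  "alternating_at h t \<sigma> m \<longleftrightarrow> (\<forall>i<m. t i < t (Suc i)) \<and> (\<forall>i\<le>m. 0 < \<sigma> * (-1) ^ i * h (t i))"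

definition alternates :: "('a::linorder \<Rightarrow> real) \<Rightarrow> 'a set \<Rightarrow> nat \<Rightarrow> bool" where
  "alternates h S m \<longleftrightarrow> (\<exists>t \<sigma>. t ` {..m} \<subseteq> S \<and> alternating_at h t \<sigma> m)"

lemma alternates_zero_iff: "alternates h S 0 \<longleftrightarrow> (\<exists>x\<in>S. h x \<noteq> 0)"
proof
  assume "\<exists>x\<in>S. h x \<noteq> 0"
  then obtain x where "x \<in> S" "h x \<noteq> 0" by blast
  then show "alternates h S 0"
    unfolding alternates_def alternating_at_def
    by (intro exI[of _ "\<lambda>_. x"] exI[of _ "h x"]) (auto simp: zero_less_mult_iff)
qed (force simp: alternates_def alternating_at_def)

lemma alternating_at_mono:
  assumes "alternating_at h t \<sigma> m" "i < j" "j \<le> m"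
  shows "t i < t j"
  using assms(2,3)
proof (induction j)
  case (Suc j)
  have "t j < t (Suc j)" using assms(1) Suc.prems by (auto simp: alternating_at_def)
  then show ?case using Suc by (cases "i = j") auto
qed simp

lemma alternating_at_Cons:
  assumes "alternating_at h t \<sigma> m" "x < t 0" "\<sigma> * h x < 0"
  shows "alternating_at h (case_nat x t) (- \<sigma>) (Suc m)"
  using assms unfolding alternating_at_def
  by (auto split: nat.split simp: less_Suc_eq_0_disj)

lemma alternates_sgn_cong:
  assumes "alternates h S m" and sgn: "\<And>x. x \<in> S \<Longrightarrow> sgn (h x) = sgn (h' x)"
  shows "alternates h' S m"
proof -
  obtain t \<sigma> where t: "t ` {..m} \<subseteq> S" "alternating_at h t \<sigma> m"
    using assms(1) unfolding alternates_def by blast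
  have "0 < c * h' x" if "x \<in> S" "0 < c * h x" for c x
    using sgn[OF that(1)] that(2) by (metis sgn_mult sgn_greater)
  then have "alternating_at h' t \<sigma> m"
    using t unfolding alternating_at_def by auto
  then show ?thesis using t(1) unfolding alternates_def by blast
qed

text \<open>
  The alternation starts at the head of the list so that the induction can compare its first sign with
  that of a new head: if they differ, the head is prepended; if they agree, it replaces the first point.
\<close>

lemma alternation_of_list:
  assumes "sorted_wrt (<) xs" "xs \<noteq> []" "\<forall>x\<in>set xs. h x \<noteq> (0::real)"
  shows "\<exists>t \<sigma>. t 0 = hd xs \<and> t ` {..list_sign_changes (map h xs)} \<subseteq> set xs \<and>
           alternating_at h t \<sigma> (list_sign_changes (map h xs))"
  using assms
proof (induction xs rule: induct_list012)
  case (2 x)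
  have "list_sign_changes [h x] = 0" by (simp add: list_sign_changes_def)
  then show ?case using 2
    by (intro exI[of _ "\<lambda>_. x"] exI[of _ "h x"]) (auto simp: alternating_at_def zero_less_mult_iff)
next
  case (3 x y zs)
  let ?l = "list_sign_changes (map h (y # zs))"
  have "sorted_wrt (<) (y # zs)" "\<forall>u\<in>set (y # zs). h u \<noteq> 0" using "3.prems" by simp_all
  from "3.IH"(2)[OF this(1) list.distinct(2) this(2)]
  obtain t \<sigma> where t: "t 0 = y" "t ` {..?l} \<subseteq> set (y # zs)" "alternating_at h t \<sigma> ?l"
    unfolding list.sel(1) by blast
  have filt: "filter (\<lambda>y. y \<noteq> 0) (map h us) = map h us" if "set us \<subseteq> set (x # y # zs)" for us
    using "3.prems"(3) that by (auto simp: filter_id_conv)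
  have count: "list_sign_changes (map h us) = card {i. Suc i < length us \<and> map h us ! i * map h us ! Suc i < 0}"
    if "set us \<subseteq> set (x # y # zs)" for us
    by (simp only: list_sign_changes_def Let_def filt[OF that] length_map)
  define M where "M = {i. Suc i < length (y # zs) \<and> map h (y # zs) ! i * map h (y # zs) ! Suc i < 0}"
  have M: "finite M" "?l = card M"
    using count[of "y # zs"] unfolding M_def
    by (auto intro: finite_subset[of _ "{..length (y # zs)}"] simp del: list.map)
  have split: "{i. Suc i < length (x # y # zs) \<and> map h (x # y # zs) ! i * map h (x # y # zs) ! Suc i < 0}
      = (if h x * h y < 0 then {0} else {}) \<union> Suc ` M" (is "?A = _")
  proof (rule set_eqI)
    show "i \<in> ?A \<longleftrightarrow> i \<in> (if h x * h y < 0 then {0} else {}) \<union> Suc ` M" for i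
      by (cases i) (auto simp: M_def)
  qed
  have l: "list_sign_changes (map h (x # y # zs)) = (if h x * h y < 0 then 1 else 0) + ?l"
    unfolding count[OF order.refl] split M(2) using M(1) by (simp add: card_image)
  have xy: "x < y" "h x \<noteq> 0" "h y \<noteq> 0" and s: "\<sigma> * h y > 0"
    using "3.prems" t(1,3) by (auto simp: alternating_at_def)
  show ?case
  proof (cases "h x * h y < 0")
    case True
    then have "\<sigma> * h x < 0" using s by (auto simp: zero_less_mult_iff mult_less_0_iff)
    then have "alternating_at h (case_nat x t) (- \<sigma>) (Suc ?l)"
      using alternating_at_Cons[OF t(3)] t(1) xy by auto
    then show ?thesis using l True t(2)
      by (intro exI[of _ "case_nat x t"] exI[of _ "- \<sigma>"]) (auto split: nat.split simp: image_subset_iff)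
  next
    case False
    then have "\<sigma> * h x > 0" using s xy by (auto simp: zero_less_mult_iff mult_less_0_iff)
    moreover have "x < t (Suc 0)" if "0 < ?l"
      using t(1,3) that xy by (auto simp: alternating_at_def)
    ultimately have "alternating_at h (t(0 := x)) \<sigma> ?l"
      using t(3) unfolding alternating_at_def by auto
    then show ?thesis using l False t(2) unfolding fun_upd_def
      by (intro exI[of _ "t(0 := x)"] exI[of _ \<sigma>]) (simp add: image_subset_iff fun_upd_def)
  qed
qed simp

lemma list_sign_changes_of_alternation:
  assumes "alternating_at h t \<sigma> m"
  shows "list_sign_changes (map (h \<circ> t) [0..<Suc m]) = m"
proof -
  have pos: "0 < \<sigma> * (-1) ^ i * h (t i)" if "i \<le> m" for i
    using assms that by (auto simp: alternating_at_def)
  have nz: "h (t i) \<noteq> 0" if "i \<le> m" for i using pos[OF that] by auto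
  have neg: "h (t i) * h (t (Suc i)) < 0" if "i < m" for i
  proof -
    have "0 < (\<sigma> * (-1) ^ i * h (t i)) * (\<sigma> * (-1) ^ Suc i * h (t (Suc i)))"
      using pos[of i] pos[of "Suc i"] that by (intro mult_pos_pos[OF pos pos]) auto
    also have "\<dots> = - ((\<sigma> * (-1) ^ i)\<^sup>2 * (h (t i) * h (t (Suc i))))"
      by (simp add: power2_eq_square)
    finally show ?thesis by (simp add: mult_less_0_iff zero_less_mult_iff)
  qed
  have "filter (\<lambda>y. y \<noteq> 0) (map (h \<circ> t) [0..<Suc m]) = map (h \<circ> t) [0..<Suc m]"
    using nz by (auto simp: filter_id_conv)
  moreover have "{i. Suc i < Suc m \<and> map (h \<circ> t) [0..<Suc m] ! i * map (h \<circ> t) [0..<Suc m] ! Suc i < 0} = {..<m}"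
    using neg by (auto simp del: upt_Suc)
  ultimately show ?thesis
    unfolding list_sign_changes_def Let_def by (simp del: upt_Suc)
qed

text \<open>
  Reduces the comparison of two suprema to alternations of each finite length, so that functions with
  infinitely many sign changes need no separate treatment.
\<close>

lemma sign_changes_le_if_alternates:
  assumes "\<And>m. alternates g {0<..<1} m \<Longrightarrow> alternates f {0<..<1} m"
  shows "sign_changes g \<le> sign_changes f"
  unfolding sign_changes_def[of g]
proof (rule SUP_least, clarify)
  fix xs :: "real list"
  assume xs: "sorted_wrt (<) xs" "set xs \<subseteq> {0<..<1}"
  define ys where "ys = filter (\<lambda>x. g x \<noteq> 0) xs"
  have "filter (\<lambda>y. y \<noteq> 0) (map g ys) = filter (\<lambda>y. y \<noteq> 0) (map g xs)"
    unfolding ys_def by (simp add: filter_map comp_def)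
  then have eq: "list_sign_changes (map g xs) = list_sign_changes (map g ys)"
    by (simp add: list_sign_changes_def)
  show "enat (list_sign_changes (map g xs)) \<le> sign_changes f"
  proof (cases "ys = []")
    case True
    then show ?thesis unfolding eq by (simp add: list_sign_changes_def zero_enat_def[symmetric])
  next
    case False
    let ?m = "list_sign_changes (map g ys)"
    have "sorted_wrt (<) ys" "set ys \<subseteq> {0<..<1}" "\<forall>x\<in>set ys. g x \<noteq> 0"
      using xs by (auto simp: ys_def sorted_wrt_filter)
    then have "alternates g {0<..<1} ?m"
      using alternation_of_list[of ys g] False unfolding alternates_def by blast
    then obtain t \<sigma> where t: "t ` {..?m} \<subseteq> {0<..<1}" "alternating_at f t \<sigma> ?m"
      using assms unfolding alternates_def by blast
    have "map t [0..<Suc ?m] \<in> {xs. sorted_wrt (<) xs \<and> set xs \<subseteq> {0<..<1}}"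
      using t(1) alternating_at_mono[OF t(2)]
      by (auto simp: sorted_wrt_iff_nth_less image_subset_iff simp del: upt_Suc)
    then have "enat (list_sign_changes (map f (map t [0..<Suc ?m]))) \<le> sign_changes f"
      unfolding sign_changes_def by (rule SUP_upper)
    then show ?thesis
      using list_sign_changes_of_alternation[OF t(2)] eq by simp
  qed
qed

section \<open>Two-term recurrences\<close>

lemma nat_crossing:
  assumes "i < j" "\<not> P i" "P j"
  obtains k where "i \<le> k" "k < j" "\<not> P k" "P (Suc k)"
proof -
  from assms have "\<exists>k. i \<le> k \<and> k < j \<and> \<not> P k \<and> P (Suc k)"
  proof (induction j)
    case (Suc j)
    show ?case
    proof (cases "P j")
      case True
      then have "i < j" using Suc.prems by (cases "i = j") auto
      then show ?thesis using Suc.IH[OF _ Suc.prems(2) True] less_SucI by blast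
    next
      case False
      then show ?thesis using Suc.prems less_Suc_eq_le by blast
    qed
  qed simp
  then show ?thesis using that by blast
qed

text \<open>
  A discrete Rolle theorem. With positive weights, between two consecutive opposite signs of \<open>c\<close> there is an
  index at which \<open>c\<close> passes to the later sign, and there the difference has that later sign as well.
  Only one sign change is lost.
\<close>

lemma alternates_of_difference:
  assumes "alternates c {..Suc n} (Suc m)"
    and "\<And>k. k \<le> n \<Longrightarrow> 0 < a k" "\<And>k. k \<le> n \<Longrightarrow> 0 < b k"
  shows "alternates (\<lambda>k. a k * c (Suc k) - b k * c k) {..n} m"
proof -
  let ?d = "\<lambda>k. a k * c (Suc k) - b k * c k"
  obtain t \<sigma> where t: "t ` {..Suc m} \<subseteq> {..Suc n}" "alternating_at c t \<sigma> (Suc m)"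
    using assms(1) unfolding alternates_def by blast
  have "\<exists>k. t i \<le> k \<and> k < t (Suc i) \<and> 0 < (- \<sigma>) * (-1) ^ i * ?d k" if "i \<le> m" for i
  proof -
    let ?s = "(- \<sigma>) * (-1) ^ i"
    have "0 < \<sigma> * (-1) ^ i * c (t i)" "0 < \<sigma> * (-1) ^ Suc i * c (t (Suc i))" "t i < t (Suc i)"
      using t(2) that unfolding alternating_at_def by auto
    then have "\<not> 0 < ?s * c (t i)" "0 < ?s * c (t (Suc i))" by simp_all
    with nat_crossing[of "t i" "t (Suc i)" "\<lambda>k. 0 < ?s * c k"] \<open>t i < t (Suc i)\<close>
    obtain k where k: "t i \<le> k" "k < t (Suc i)" "\<not> 0 < ?s * c k" "0 < ?s * c (Suc k)" by blast
    have "k \<le> n" using k(2) t(1) that by (force simp: image_subset_iff)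
    then have "0 < a k * (?s * c (Suc k))" "b k * (?s * c k) \<le> 0"
      using assms(2,3)[of k] k(3,4) by (meson mult_pos_pos mult_nonneg_nonpos less_imp_le not_less)+
    then have "0 < ?s * ?d k" by (simp only: right_diff_distrib mult.left_commute)
    then show ?thesis using k by blast
  qed
  then obtain u where u: "\<And>i. i \<le> m \<Longrightarrow> t i \<le> u i \<and> u i < t (Suc i) \<and> 0 < (- \<sigma>) * (-1) ^ i * ?d (u i)"
    by metis
  have "u i < u (Suc i)" if "i < m" for i using u[of i] u[of "Suc i"] that by auto
  moreover have "u i \<le> n" if "i \<le> m" for i
    using u[OF that] t(1) that by (force simp: image_subset_iff)
  ultimately show ?thesis
    unfolding alternates_def alternating_at_def using u
    by (intro exI[of _ u] exI[of _ "- \<sigma>"]) auto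
qed

text \<open>
  The coefficient form of Descartes' argument that a positive root costs a sign change. Extended by
  zeros on both sides, \<open>e\<close> crosses between consecutive alternation points, and also on entering the first
  and leaving the last one; these \<open>m + 2\<close> crossings are alternation points of \<open>c\<close>.
\<close>

lemma alternates_of_factor_extension:
  fixes e c :: "nat \<Rightarrow> real"
  assumes "alternates e {..n} m" and "e (Suc n) = 0"
    and "\<And>k. k \<le> n \<Longrightarrow> 0 < a k" "0 < b"
    and c0: "c 0 = - b * e 0" and cS: "\<And>k. k \<le> n \<Longrightarrow> c (Suc k) = a k * e k - b * e (Suc k)"
  shows "alternates c {..Suc n} (Suc m)"
proof -
  obtain t \<sigma> where t: "t ` {..m} \<subseteq> {..n}" "alternating_at e t \<sigma> m"
    using assms(1) unfolding alternates_def by blast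
  have tn: "t i \<le> n" if "i \<le> m" for i using t(1) that by auto
  \<comment> \<open>E is e padded by a zero in front, and T lists its alternation points
    together with the two positions 0 and n + 2 where E vanishes.\<close>
  define E where "E = case_nat 0 e"
  define T where "T i = (if i = 0 then 0 else if i \<le> Suc m then Suc (t (i - 1)) else Suc (Suc n))" for i
  have T0: "T 0 = 0" "T (Suc (Suc m)) = Suc (Suc n)" and TS: "\<And>i. i \<le> m \<Longrightarrow> T (Suc i) = Suc (t i)"
    by (auto simp: T_def)
  have E0: "E (T 0) = 0" "E (T (Suc (Suc m))) = 0" using T0 assms(2) by (simp_all add: E_def)
  have ET: "0 < \<sigma> * (-1) ^ i * E (T (Suc i))" if "i \<le> m" for i
    using t(2) TS[OF that] that by (simp add: E_def alternating_at_def)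
  have T_less: "T i < T (Suc i)" if "i \<le> Suc m" for i
    using that T0 TS[of i] TS[of "i - 1"] t(2) tn[of m]
    by (cases i; cases "i = Suc m") (auto simp: alternating_at_def)
  have cE: "c k = a' k * E k - b * E (Suc k)" if "k \<le> Suc n" "a' = case_nat 1 a" for k a'
    using c0 cS that by (cases k) (auto simp: E_def)
  define a' where "a' = case_nat 1 a"
  have a': "0 < a' k" if "k \<le> Suc n" for k
    using assms(3) that by (auto simp: a'_def split: nat.split)
  have "\<exists>k. T i \<le> k \<and> k < T (Suc i) \<and> 0 < (- \<sigma>) * (-1) ^ i * c k" if i: "i \<le> Suc m" for i
  proof -
    let ?s = "\<sigma> * (-1) ^ i"
    have lo: "?s * E (T i) \<le> 0" using ET[of "i - 1"] E0 i by (cases i) auto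
    have hi: "0 \<le> ?s * E (T (Suc i))" using ET[of i] E0 i by (cases "i = Suc m") auto
    have le: "T (Suc i) \<le> Suc (Suc n)"
      using i T0 TS[of i] tn[of i] by (cases "i = Suc m") auto
    obtain k where k: "T i \<le> k" "k < T (Suc i)" "?s * E k \<le> 0" "0 \<le> ?s * E (Suc k)"
      "?s * E k < 0 \<or> 0 < ?s * E (Suc k)"
    proof (cases "i = Suc m")
      case True
      then have "?s * E (T i) < 0" using ET[of m] by simp
      then show ?thesis
        using nat_crossing[of "T i" "T (Suc i)" "\<lambda>k. 0 \<le> ?s * E k"] T_less[OF i] hi that
        by (metis less_eq_real_def not_le)
    next
      case False
      then have "0 < ?s * E (T (Suc i))" using ET[of i] i by simp
      then show ?thesis
        using nat_crossing[of "T i" "T (Suc i)" "\<lambda>k. 0 < ?s * E k"] T_less[OF i] lo that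
        by (metis less_eq_real_def not_le)
    qed
    have kn: "k \<le> Suc n" using k(2) le by simp
    have "a' k * (?s * E k) - b * (?s * E (Suc k)) < 0"
    proof -
      have "a' k * (?s * E k) \<le> 0" "0 \<le> b * (?s * E (Suc k))"
        using k(3,4) a'[OF kn] assms(4) by (auto intro: mult_nonneg_nonpos mult_nonneg_nonneg)
      moreover have "a' k * (?s * E k) < 0 \<or> 0 < b * (?s * E (Suc k))"
        using k(5) a'[OF kn] assms(4) by (meson mult_pos_neg mult_pos_pos)
      ultimately show ?thesis by linarith
    qed
    then have "?s * c k < 0"
      unfolding cE[OF kn a'_def] by (simp only: right_diff_distrib mult.left_commute)
    then show ?thesis using k by auto
  qed
  then obtain u where u: "\<And>i. i \<le> Suc m \<Longrightarrow> T i \<le> u i \<and> u i < T (Suc i) \<and> 0 < (- \<sigma>) * (-1) ^ i * c (u i)"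
    by metis
  have "u i < u (Suc i)" if "i < Suc m" for i using u[of i] u[of "Suc i"] that by auto
  moreover have "u i \<le> Suc n" if "i \<le> Suc m" for i
  proof -
    have "T (Suc i) \<le> Suc (Suc n)" using that T0 TS[of i] tn[of i] by (cases "i = Suc m") auto
    then show ?thesis using u[OF that] by simp
  qed
  ultimately show ?thesis
    unfolding alternates_def alternating_at_def using u
    by (intro exI[of _ u] exI[of _ "- \<sigma>"]) auto
qed

text \<open>
  Flipping the sign from the first sign change \<open>j\<close> onwards removes exactly that change, so an alternation
  of the flipped sequence can be lengthened by one for \<open>v\<close>. Since the natural numbers are well-ordered,
  a first sign change exists even when there are infinitely many.
\<close>

lemma first_sign_change:
  fixes v :: "nat \<Rightarrow> real"
  assumes "v i1 > 0" "v i2 < 0"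
  obtains j where "j > 0"
    "\<And>m. alternates (\<lambda>i. if i < j then v i else - v i) UNIV m \<Longrightarrow> alternates v UNIV (Suc m)"
proof -
  define i0 where "i0 = (LEAST i. v i \<noteq> 0)"
  have i0: "v i0 \<noteq> 0" unfolding i0_def by (rule LeastI[of _ i1]) (use assms in auto)
  have "\<exists>i. v i0 * v i < 0" using i0 assms by (metis mult_less_0_iff linorder_neqE_linordered_idom)
  define j where "j = (LEAST i. v i0 * v i < 0)"
  have j: "v i0 * v j < 0" unfolding j_def using \<open>\<exists>i. v i0 * v i < 0\<close> by (rule LeastI_ex)
  have before_j: "0 \<le> v i0 * v i" if "i < j" for i
    using not_less_Least[of i "\<lambda>i. v i0 * v i < 0"] that unfolding j_def by simp
  have "i0 \<le> j" unfolding i0_def by (rule Least_le) (use j in auto)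
  moreover have "i0 \<noteq> j" using j by (auto simp: mult_less_0_iff)
  ultimately have i0j: "i0 < j" by simp
  show ?thesis
  proof (rule that[of j])
    show "0 < j" using i0j by simp
  next
    fix m
    let ?g = "\<lambda>i. if i < j then v i else - v i"
    assume "alternates ?g UNIV m"
    then obtain t \<sigma> where t: "alternating_at ?g t \<sigma> m" unfolding alternates_def by blast
    have pos: "0 < \<sigma> * (-1) ^ i * ?g (t i)" if "i \<le> m" for i
      using t that by (auto simp: alternating_at_def)
    \<comment> \<open>On the indices up to j the flipped sequence is nowhere of sign opposite to v i0,
      so at most the first alternation point lies below j, and it can be moved to j.\<close>
    define t' where "t' = t(0 := max j (t 0))"
    have sj: "0 < \<sigma> * ?g j" if "t 0 < j"
      using pos[of 0] before_j[OF that] j that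
      by (auto simp: zero_less_mult_iff mult_less_0_iff zero_le_mult_iff)
    have step: "j < t 1" if "t 0 < j" "0 < m"
    proof (rule ccontr)
      assume "\<not> j < t 1"
      then have "\<sigma> * ?g (t 1) < 0" "0 \<le> v i0 * ?g (t 1)"
        using pos[of 1] that j before_j by (auto simp: not_less_iff_gr_or_eq)
      then show False using sj[OF that(1)] j
        by (auto simp: zero_less_mult_iff mult_less_0_iff zero_le_mult_iff split: if_splits)
    qed
    have t': "alternating_at ?g t' \<sigma> m" "j \<le> t' 0"
      using t sj step unfolding alternating_at_def t'_def by (auto simp: max_def)
    have "t' 0 \<le> t' i" if "i \<le> m" for i
      using alternating_at_mono[OF t'(1), of 0 i] that by (cases "i = 0") auto
    then have v: "alternating_at v t' (- \<sigma>) m"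
      using t' unfolding alternating_at_def by (auto split: if_splits) (meson dual_order.trans leD)+
    have s: "(- \<sigma>) * v (t' 0) > 0" using v by (auto simp: alternating_at_def)
    \<comment> \<open>Prepend whichever of the two witnesses of the first sign change has the right sign.\<close>
    have "\<exists>x. x < t' 0 \<and> (- \<sigma>) * v x < 0"
    proof (cases "(- \<sigma>) * v j > 0")
      case True
      then have "(- \<sigma>) * v i0 < 0"
        using j by (auto simp: zero_less_mult_iff mult_less_0_iff)
      then show ?thesis using i0j t'(2) by (intro exI[of _ i0]) auto
    next
      case False
      then have "(- \<sigma>) * v j < 0" using j s by (auto simp: zero_less_mult_iff mult_less_0_iff)
      moreover have "t' 0 \<noteq> j" using s False by auto
      ultimately show ?thesis using t'(2) by (intro exI[of _ j]) auto
    qed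
    then show "alternates v UNIV (Suc m)"
      using alternating_at_Cons[OF v] unfolding alternates_def by blast
  qed
qed

section \<open>The q-Bernstein kernel\<close>

text \<open>
  The q-Bernstein polynomial without its q-binomial coefficient. The same kernel describes both halves
  of the operator: \<open>x\<close> is the argument of the polynomial in one, and a node \<open>q\<^bsup>\<beta>+1+i\<^esup>\<close> of the Jackson integral
  in the other.
\<close>

definition q_kernel :: "real \<Rightarrow> nat \<Rightarrow> nat \<Rightarrow> real \<Rightarrow> real" where
  "q_kernel q n k x = x ^ k * (\<Prod>j<n - k. 1 - q ^ j * x)"

text \<open>
  The identity behind the whole proof: for \<open>0 < z < 1\<close> a difference of neighbouring kernels with positive
  weights is the kernel of one degree lower times a linear factor with a prescribed zero \<open>z\<close>. It follows from
  \<open>x (1 - z q\<^sup>m) - z (1 - q\<^sup>m x) = x - z\<close> for \<open>m = n - k\<close>.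
\<close>

lemma q_kernel_factor:
  assumes "k \<le> n"
  shows "(1 - z * q ^ (n - k)) * q_kernel q (Suc n) (Suc k) x - z * q_kernel q (Suc n) k x
       = (x - z) * q_kernel q n k x"
  using assms by (simp add: q_kernel_def Suc_diff_le algebra_simps)

lemma power_mult_less_one:
  assumes "0 < q" "q < 1" "0 \<le> x" "x < (1::real)"
  shows "q ^ j * x < 1"
proof -
  have "q ^ j * x \<le> 1 * x" using assms by (intro mult_right_mono power_le_one) auto
  then show ?thesis using assms by simp
qed

lemma q_kernel_bounds:
  assumes "0 < q" "q < 1" "0 < x" "x < 1"
  shows "0 < q_kernel q n k x" "q_kernel q n k x \<le> 1"
proof -
  have *: "0 < 1 - q ^ j * x" "1 - q ^ j * x \<le> 1" for j
    using power_mult_less_one[of q x j] assms by auto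
  show "0 < q_kernel q n k x"
    unfolding q_kernel_def using * assms by (intro mult_pos_pos prod_pos) auto
  show "q_kernel q n k x \<le> 1"
    unfolding q_kernel_def using * assms
    by (intro mult_le_one power_le_one prod_le_1 prod_nonneg) (auto simp: less_imp_le)
qed

text \<open>
  Synthetic division in the kernel basis: for \<open>a k = 1 - z q\<^bsup>n-k\<^esup>\<close>, the coefficients of the quotient by \<open>x - z\<close>
  stand at the indices up to \<open>n\<close>, and the entry at \<open>n + 1\<close> determines the remainder.
\<close>

primrec deflate :: "(nat \<Rightarrow> real) \<Rightarrow> (nat \<Rightarrow> real) \<Rightarrow> real \<Rightarrow> nat \<Rightarrow> real" where
  "deflate a c z 0 = - c 0 / z"
| "deflate a c z (Suc k) = (a k * deflate a c z k - c (Suc k)) / z"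

text \<open>
  Division with remainder by \<open>x - z\<close>, where the remainder is a multiple of \<open>x\<^bsup>n+1\<^esup>\<close>, the last kernel,
  instead of a constant. It vanishes exactly when \<open>z\<close> is a root.
\<close>

lemma q_kernel_sum_deflate:
  fixes q z :: real and c :: "nat \<Rightarrow> real" and n :: nat
  defines "e \<equiv> deflate (\<lambda>k. 1 - z * q ^ (n - k)) c z"
  assumes "z \<noteq> 0"
  shows "(\<Sum>k\<le>Suc n. c k * q_kernel q (Suc n) k x)
       = (x - z) * (\<Sum>k\<le>n. e k * q_kernel q n k x) - z * e (Suc n) * x ^ Suc n"
proof -
  let ?K = "\<lambda>k. q_kernel q (Suc n) k x"
  have c0: "c 0 = - z * e 0" and cS: "c (Suc k) = (1 - z * q ^ (n - k)) * e k - z * e (Suc k)" for k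
    using assms by simp_all
  have "(\<Sum>k\<le>Suc n. c k * ?K k) = c 0 * ?K 0 + (\<Sum>k\<le>n. c (Suc k) * ?K (Suc k))"
    by (rule sum.atMost_Suc_shift)
  also have "\<dots> = (\<Sum>k\<le>n. (1 - z * q ^ (n - k)) * e k * ?K (Suc k))
                   - z * (e 0 * ?K 0 + (\<Sum>k\<le>n. e (Suc k) * ?K (Suc k)))"
    by (simp add: c0 cS algebra_simps sum_subtractf sum.distrib sum_distrib_left)
  also have "e 0 * ?K 0 + (\<Sum>k\<le>n. e (Suc k) * ?K (Suc k)) = (\<Sum>k\<le>Suc n. e k * ?K k)"
    by (rule sum.atMost_Suc_shift[symmetric])
  also have "\<dots> = (\<Sum>k\<le>n. e k * ?K k) + e (Suc n) * ?K (Suc n)"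
    by (rule sum.atMost_Suc)
  also have "(\<Sum>k\<le>n. (1 - z * q ^ (n - k)) * e k * ?K (Suc k)) - z * ((\<Sum>k\<le>n. e k * ?K k) + e (Suc n) * ?K (Suc n))
     = (\<Sum>k\<le>n. e k * ((1 - z * q ^ (n - k)) * ?K (Suc k) - z * ?K k)) - z * e (Suc n) * ?K (Suc n)"
    by (simp add: algebra_simps sum_subtractf sum.distrib sum_distrib_left)
  also have "(\<Sum>k\<le>n. e k * ((1 - z * q ^ (n - k)) * ?K (Suc k) - z * ?K k))
     = (\<Sum>k\<le>n. e k * ((x - z) * q_kernel q n k x))"
    by (intro sum.cong refl) (simp add: q_kernel_factor)
  also have "\<dots> = (x - z) * (\<Sum>k\<le>n. e k * q_kernel q n k x)"
    by (simp add: sum_distrib_left mult.left_commute)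
  finally show ?thesis by (simp add: q_kernel_def)
qed

text \<open>
  Descartes' rule of signs for the q-Bernstein basis. A root between the first two alternation points
  is split off; the quotient keeps the remaining signs and has one sign change less, and by
  \<open>alternates_of_factor_extension\<close> its coefficients have at least one sign change less than \<open>c\<close>.
\<close>

lemma alternates_coefficients:
  assumes q: "0 < q" "q < 1"
    and "alternates (\<lambda>x. \<Sum>k\<le>n. c k * q_kernel q n k x) {0<..<1} m"
  shows "alternates c {..n} m"
  using assms(3)
proof (induction m arbitrary: n c)
  case 0
  then show ?case unfolding alternates_zero_iff by (auto intro: ccontr)
next
  case (Suc m)
  let ?p = "\<lambda>n c x. \<Sum>k\<le>n. c k * q_kernel q n k x"
  obtain t \<sigma> where t: "t ` {..Suc m} \<subseteq> {0<..<1}" "alternating_at (?p n c) t \<sigma> (Suc m)"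
    using Suc.prems unfolding alternates_def by blast
  have sgn0: "0 < \<sigma> * ?p n c (t 0)" and sgn1: "\<sigma> * ?p n c (t 1) < 0" and t01: "t 0 < t 1"
    and tpos: "0 < t 0" "t 1 < 1"
    using t(2)[unfolded alternating_at_def, THEN conjunct2, rule_format, of 0]
      t(2)[unfolded alternating_at_def, THEN conjunct2, rule_format, of 1]
      t(2)[unfolded alternating_at_def, THEN conjunct1, rule_format, of 0] t(1)
    by (simp_all add: image_subset_iff)
  have "continuous_on {t 0..t 1} (\<lambda>x. - \<sigma> * ?p n c x)"
    unfolding q_kernel_def by (intro continuous_intros)
  then obtain z where z: "t 0 \<le> z" "z \<le> t 1" "\<sigma> * ?p n c z = 0"
    using IVT'[of "\<lambda>x. - \<sigma> * ?p n c x" "t 0" 0 "t 1"] sgn0 sgn1 t01 by auto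
  then have pz: "?p n c z = 0" and z01: "0 < z" "z < t 1" "z < 1"
    using sgn0 sgn1 tpos by (auto simp: less_le)
  obtain n' where n: "n = Suc n'"
    using pz sgn0 by (cases n) (auto simp: q_kernel_def)
  let ?a = "\<lambda>k. 1 - z * q ^ (n' - k)"
  define e where "e = deflate ?a c z"
  have "z * e (Suc n') * z ^ Suc n' = 0"
    using q_kernel_sum_deflate[of z c q n' z] pz z01 unfolding n e_def by simp
  then have eS: "e (Suc n') = 0" using z01 by simp
  then have factor: "?p n c x = (x - z) * ?p n' e x" for x
    using q_kernel_sum_deflate[of z c q n' x] z01 unfolding n e_def by simp
  have "alternating_at (?p n' e) (\<lambda>i. t (Suc i)) (- \<sigma>) m"
    unfolding alternating_at_def
  proof (intro conjI allI impI)
    fix i assume i: "i \<le> m"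
    have "t 1 \<le> t (Suc i)"
      using alternating_at_mono[OF t(2), of 1 "Suc i"] i by (cases "i = 0") auto
    then have "0 < t (Suc i) - z" using z01 by simp
    moreover have "0 < \<sigma> * (-1) ^ Suc i * ?p n c (t (Suc i))"
      using t(2) i unfolding alternating_at_def by blast
    then have "0 < (t (Suc i) - z) * (- \<sigma> * (-1) ^ i * ?p n' e (t (Suc i)))"
      unfolding factor by (simp only: power_Suc mult_ac mult_minus_left mult_minus_right mult_1_left mult_1_right)
    ultimately show "0 < - \<sigma> * (-1) ^ i * ?p n' e (t (Suc i))"
      by (simp only: zero_less_mult_pos)
  qed (use t(2) in \<open>auto simp: alternating_at_def\<close>)
  then have "alternates (?p n' e) {0<..<1} m"
    unfolding alternates_def using t(1)
    by (intro exI[of _ "\<lambda>i. t (Suc i)"] exI[of _ "- \<sigma>"]) (auto simp: image_subset_iff)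
  then have "alternates e {..n'} m" by (rule Suc.IH)
  moreover have "0 < ?a k" for k
    using power_mult_less_one[of q z "n' - k"] q z01 by (simp add: mult.commute)
  ultimately show ?case
    unfolding n using eS z01
    by (intro alternates_of_factor_extension[where e = e and a = ?a and b = z])
      (auto simp: e_def)
qed

lemma summable_mult_bounded:
  fixes v g :: "nat \<Rightarrow> real"
  assumes "summable (\<lambda>i. \<bar>v i\<bar>)" "\<And>i. \<bar>g i\<bar> \<le> 1"
  shows "summable (\<lambda>i. \<bar>v i * g i\<bar>)"
  using assms(1)
proof (rule summable_comparison_test')
  show "norm \<bar>v i * g i\<bar> \<le> \<bar>v i\<bar>" for i
    using mult_left_mono[OF assms(2)[of i], of "\<bar>v i\<bar>"] by (simp add: abs_mult)
qed

text \<open>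
  The transposed rule of signs. If \<open>z\<close> separates the nodes on the two sides of the first sign change of \<open>v\<close>,
  then \<open>v i (y i - z)\<close> has one sign change less than \<open>v\<close>; its moments of degree \<open>n - 1\<close> are weighted
  differences of the moments of \<open>v\<close>, by \<open>q_kernel_factor\<close>, and so lose at most one sign change.
\<close>

lemma alternates_moments:
  assumes q: "0 < q" "q < 1"
    and y: "\<And>i. 0 < y i" "\<And>i. y i < 1" "\<And>i. y (Suc i) < y i"
    and "summable (\<lambda>i. \<bar>v i\<bar>)"
    and "alternates (\<lambda>k. \<Sum>i. v i * q_kernel q n k (y i)) {..n} m"
  shows "alternates v UNIV m"
  using assms(6,7)
proof (induction m arbitrary: n v)
  case 0
  then show ?case unfolding alternates_zero_iff by (auto intro: ccontr)
next
  case (Suc m)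
  let ?c = "\<lambda>n v k. \<Sum>i. v i * q_kernel q n k (y i)"
  have ker: "0 \<le> q_kernel q n k (y i)" "\<bar>q_kernel q n k (y i)\<bar> \<le> 1" for n k i
    using q_kernel_bounds[of q "y i" n k] q y by auto
  have summ: "summable (\<lambda>i. v i * q_kernel q n k (y i))" if "summable (\<lambda>i. \<bar>v i\<bar>)" for v n k
    using summable_mult_bounded[OF that, of "\<lambda>i. q_kernel q n k (y i)"] ker
    by (auto intro: summable_rabs_cancel)
  obtain t \<sigma> where t: "alternating_at (?c n v) t \<sigma> (Suc m)" "t ` {..Suc m} \<subseteq> {..n}"
    using Suc.prems(2) unfolding alternates_def by blast
  have s0: "0 < \<sigma> * ?c n v (t 0)" and s1: "\<sigma> * ?c n v (t 1) < 0"
    using t(1) unfolding alternating_at_def by force+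
  have both: "\<exists>i. 0 < s * v i" if "0 < s * ?c n v k" for s k
  proof (rule ccontr)
    assume "\<not> ?thesis"
    then have "0 \<le> (\<Sum>i. - (s * (v i * q_kernel q n k (y i))))"
      using ker summ[OF Suc.prems(1)]
      by (intro suminf_nonneg summable_minus summable_mult)
        (auto simp: not_less mult.assoc[symmetric] intro: mult_nonpos_nonneg)
    then show False
      using that summ[OF Suc.prems(1)] by (simp add: suminf_minus suminf_mult summable_mult)
  qed
  have "\<exists>i. 0 < \<sigma> * v i" "\<exists>i. 0 < - \<sigma> * v i" using both[of \<sigma>] both[of "- \<sigma>"] s0 s1 by auto
  then obtain i1 i2 where "v i1 > 0" "v i2 < 0" by (auto simp: zero_less_mult_iff mult_less_0_iff)
  from first_sign_change[where v = v, OF this] obtain j where j: "j > 0" "\<And>m. alternates (\<lambda>i. if i < j then v i else - v i) UNIV m \<Longrightarrow> alternates v UNIV (Suc m)"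
    by metis
  obtain z where z: "y j < z" "z < y (j - 1)"
    using dense[of "y j" "y (j - 1)"] y(3)[of "j - 1"] j(1) by auto
  have z01: "0 < z" "z < 1" using z y(1)[of j] y(2)[of "j - 1"] by auto
  have dec: "decseq y" using y(3) by (intro decseq_SucI) (simp add: less_imp_le)
  let ?g = "\<lambda>i. v i * (y i - z)"
  have sgn_g: "sgn (?g i) = sgn (if i < j then v i else - v i)" for i
  proof (cases "i < j")
    case True
    then have "y (j - 1) \<le> y i" by (intro decseqD[OF dec]) simp
    then show ?thesis using z True by (simp add: sgn_mult)
  next
    case False
    then have "y i \<le> y j" by (intro decseqD[OF dec]) simp
    then show ?thesis using z False by (simp add: sgn_mult)
  qed
  have gv: "alternates v UNIV (Suc m)" if "alternates ?g UNIV m"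
    by (rule j(2), rule alternates_sgn_cong[OF that], rule sgn_g)
  have "\<bar>y i - z\<bar> \<le> 1" for i using y(1)[of i] y(2)[of i] z01 by (simp add: abs_le_iff)
  then have gsum: "summable (\<lambda>i. \<bar>?g i\<bar>)" by (rule summable_mult_bounded[OF Suc.prems(1)])
  obtain n' where n: "n = Suc n'"
    using t alternating_at_mono[OF t(1), of 0 1] by (cases n) (auto simp: image_subset_iff)
  let ?a = "\<lambda>k. 1 - z * q ^ (n' - k)"
  have a: "0 < ?a k" for k
    using power_mult_less_one[of q z "n' - k"] q z01 by (simp add: mult.commute)
  have "?c n' ?g k = ?a k * ?c n v (Suc k) - z * ?c n v k" if "k \<le> n'" for k
  proof -
    have "?a k * ?c n v (Suc k) - z * ?c n v k
        = (\<Sum>i. ?a k * (v i * q_kernel q n (Suc k) (y i)) - z * (v i * q_kernel q n k (y i)))"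
      using summ[OF Suc.prems(1)]
      by (simp only: suminf_mult[symmetric] suminf_diff summable_mult)
    also have "\<dots> = (\<Sum>i. v i * (?a k * q_kernel q n (Suc k) (y i) - z * q_kernel q n k (y i)))"
      by (simp add: algebra_simps)
    also have "\<dots> = ?c n' ?g k" unfolding n q_kernel_factor[OF that] by (simp add: mult.assoc)
    finally show ?thesis by simp
  qed
  moreover have "alternates (\<lambda>k. ?a k * ?c n v (Suc k) - z * ?c n v k) {..n'} m"
    using Suc.prems(2) a z01 unfolding n by (intro alternates_of_difference)
  ultimately have "alternates (?c n' ?g) {..n'} m"
    using alternates_sgn_cong[of "\<lambda>k. ?a k * ?c n v (Suc k) - z * ?c n v k" "{..n'}" m "?c n' ?g"] by simp
  then show ?case by (intro gv Suc.IH[OF gsum])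
qed

section \<open>Infinite q-products\<close>

lemma convergent_prod_q_pochhammer:
  fixes q x :: real
  assumes "0 < q" "q < 1" "0 \<le> x" "x < 1"
  shows "convergent_prod (\<lambda>j. 1 - q ^ j * x)"
proof -
  have "summable (\<lambda>j. \<bar>- (q ^ j * x)\<bar>)"
    using assms by (simp add: abs_mult summable_mult2 summable_geometric)
  moreover have "- (q ^ j * x) \<noteq> -1" for j
    using power_mult_less_one[OF assms, of j] by simp
  ultimately show ?thesis
    using summable_imp_convergent_prod_real[of "\<lambda>j. - (q ^ j * x)"] by simp
qed

lemma q_pochhammer_pos:
  fixes q x :: real
  assumes "0 < q" "q < 1" "0 \<le> x" "x < 1"
  shows "0 < (\<Prod>j. 1 - q ^ j * x)"
  using power_mult_less_one[OF assms] by (intro less_0_prodinf convergent_prod_q_pochhammer assms) simp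

lemma q_pochhammer_split:
  fixes q x :: real
  assumes "0 < q" "q < 1" "0 \<le> x" "x < 1"
  shows "(\<Prod>j. 1 - q ^ j * x) = (\<Prod>j. 1 - q ^ j * (q ^ m * x)) * (\<Prod>j<m. 1 - q ^ j * x)"
proof -
  have "1 - q ^ j * x \<noteq> 0" for j using power_mult_less_one[OF assms, of j] by simp
  then show ?thesis
    using prodinf_split_initial_segment[OF convergent_prod_q_pochhammer[OF assms], of m]
    by (simp add: power_add mult.assoc)
qed

text \<open>
  For negative \<open>a\<close> the argument \<open>q\<^sup>a x\<close> of the denominator may exceed \<open>x\<close>; the last assumption keeps it
  below 1, so that no factor of the denominator vanishes.
\<close>

lemma q_power_eq_quotient:
  assumes "0 < q" "q < 1" "0 \<le> x" "x < 1" "q powr a * x < 1"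
  shows "q_power q x a = (\<Prod>j. 1 - q ^ j * x) / (\<Prod>j. 1 - q ^ j * (q powr a * x))"
proof -
  have "(\<Prod>j. 1 - q ^ j * x) / (\<Prod>j. 1 - q ^ j * (q powr a * x))
      = (\<Prod>j. (1 - q ^ j * x) / (1 - q ^ j * (q powr a * x)))"
    using assms by (intro prodinf_divide convergent_prod_q_pochhammer) auto
  then show ?thesis
    using assms by (simp add: q_power_def powr_add powr_realpow mult.assoc)
qed

lemma q_power_add_nat:
  assumes "0 < q" "q < 1" "0 \<le> x" "x < 1" "q powr a * x < 1"
  shows "q_power q x (real m + a) = q_power q x a * (\<Prod>j<m. 1 - q ^ j * (q powr a * x))"
proof -
  have shift: "q powr (real m + a) * x = q ^ m * (q powr a * x)"
    using assms by (simp add: powr_add powr_realpow)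
  have ax: "0 \<le> q powr a * x" using assms by simp
  have "q ^ j * (q powr a * x) < 1" for j
    using power_mult_less_one[of q "q powr a * x" j] assms ax by simp
  then have "(\<Prod>j<m. 1 - q ^ j * (q powr a * x)) \<noteq> 0" by (auto simp: less_le)
  moreover have "q powr (real m + a) * x < 1"
    unfolding shift using power_mult_less_one[of q "q powr a * x" m] assms ax by simp
  ultimately show ?thesis
    using q_power_eq_quotient[OF assms(1-4), of "real m + a"] q_power_eq_quotient[OF assms]
      q_pochhammer_split[of q "q powr a * x" m] assms ax
    by (simp add: shift)
qed

lemma q_power_nat:
  assumes "0 < q" "q < 1" "0 \<le> x" "x < 1"
  shows "q_power q x (real m) = (\<Prod>j<m. 1 - q ^ j * x)"
proof -
  have "q_power q x 0 = 1"
    using q_power_eq_quotient[of q x 0] q_pochhammer_pos[of q x] assms by simp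
  then show ?thesis using q_power_add_nat[of q x 0 m] assms by simp
qed

text \<open>
  The bound depends on \<open>y\<close> alone, so it is uniform over all points \<open>x\<close> with \<open>q\<^sup>a x \<le> y\<close>;
  this makes it usable under the Jackson sum.
\<close>

lemma q_power_bounds:
  assumes "0 < q" "q < 1" "0 \<le> x" "x < 1" "q powr a * x \<le> y" "y < 1"
  shows "0 < q_power q x a" "q_power q x a \<le> 1 / (\<Prod>j. 1 - q ^ j * y)"
proof -
  have ax: "0 \<le> q powr a * x" "q powr a * x < 1" "0 \<le> y"
    using assms by (auto intro: order_trans[rotated])
  have num: "(\<Prod>j. 1 - q ^ j * x) \<le> 1"
    using power_mult_less_one[OF assms(1-4)] assms
    by (intro prodinf_le_const[of _ 0] convergent_prod_q_pochhammer prod_le_1) (auto simp: less_imp_le)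
  have "(\<Prod>j. 1 - q ^ j * y) \<le> (\<Prod>j. 1 - q ^ j * (q powr a * x))"
    using power_mult_less_one[of q y] assms ax
    by (intro prodinf_le[OF convergent_prod_has_prod convergent_prod_has_prod] convergent_prod_q_pochhammer)
      (auto simp: less_imp_le intro!: mult_left_mono)
  moreover have "0 < (\<Prod>j. 1 - q ^ j * y)" "0 < (\<Prod>j. 1 - q ^ j * x)"
    using q_pochhammer_pos assms ax by auto
  ultimately show "0 < q_power q x a" "q_power q x a \<le> 1 / (\<Prod>j. 1 - q ^ j * y)"
    unfolding q_power_eq_quotient[OF assms(1-4) ax(2)] using num
    by (auto intro!: divide_pos_pos frac_le)
qed

lemma q_binomial_pos:
  assumes "0 < q" "q < 1"
  shows "0 < q_binomial q n k"
proof -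
  have "0 < q_fact q n" for n
    unfolding q_fact_def q_number_def using assms
    by (intro prod_pos) (auto intro!: divide_pos_pos simp: powr01_less_one)
  then show ?thesis unfolding q_binomial_def by simp
qed

lemma q_bernstein_eq_kernel:
  assumes "0 < q" "q < 1" "0 \<le> x" "x < 1"
  shows "q_bernstein q n k x = q_binomial q n k * q_kernel q n k x"
  using q_power_nat[OF assms] by (simp add: q_bernstein_def q_kernel_def)

section \<open>Durrmeyer coefficients\<close>

definition durrmeyer_node :: "real \<Rightarrow> real \<Rightarrow> nat \<Rightarrow> real" where
  "durrmeyer_node q \<beta> i = q powr (\<beta> + 1) * q ^ i"

text \<open>
  The weight of the measure \<open>t\<^sup>\<alpha> (1 - q t)\<^sub>q\<^sup>\<beta> d\<^sub>q t\<close> at \<open>t = q\<^sup>i\<close>, up to the factor \<open>1 - q\<close>: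
  the part of the integrand that depends on neither \<open>k\<close> nor \<open>f\<close>.
\<close>

definition durrmeyer_weight :: "real \<Rightarrow> real \<Rightarrow> real \<Rightarrow> nat \<Rightarrow> real" where
  "durrmeyer_weight q \<alpha> \<beta> i = q ^ i * (q ^ i) powr \<alpha> * q_power q (q * q ^ i) \<beta>"

lemma durrmeyer_node_bounds:
  assumes "0 < q" "q < 1" "\<beta> > -1"
  shows "0 < durrmeyer_node q \<beta> i" "durrmeyer_node q \<beta> i < 1"
    "durrmeyer_node q \<beta> (Suc i) < durrmeyer_node q \<beta> i"
    "durrmeyer_node q \<beta> i \<le> q powr (\<beta> + 1)" "q powr (\<beta> + 1) < 1"
proof -
  show 1: "q powr (\<beta> + 1) < 1" using assms by (simp add: powr01_less_one)
  show "0 < durrmeyer_node q \<beta> i" "durrmeyer_node q \<beta> (Suc i) < durrmeyer_node q \<beta> i"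
    using assms by (simp_all add: durrmeyer_node_def)
  show 2: "durrmeyer_node q \<beta> i \<le> q powr (\<beta> + 1)"
    using assms by (simp add: durrmeyer_node_def mult_left_le power_le_one)
  show "durrmeyer_node q \<beta> i < 1" using 1 2 by simp
qed

lemma durrmeyer_node_shift: "0 < q \<Longrightarrow> q powr \<beta> * (q * q ^ i) = durrmeyer_node q \<beta> i"
  by (simp add: durrmeyer_node_def powr_add)

lemma durrmeyer_weight_bounds:
  assumes "0 < q" "q < 1" "\<beta> > -1"
  shows "0 < durrmeyer_weight q \<alpha> \<beta> i"
    "durrmeyer_weight q \<alpha> \<beta> i \<le> q ^ i * (q ^ i) powr \<alpha> * (1 / (\<Prod>j. 1 - q ^ j * q powr (\<beta> + 1)))"
proof -
  have "0 \<le> q * q ^ i" "q * q ^ i < 1"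
    using assms power_Suc_less_one[of q i] by simp_all
  note b = q_power_bounds[OF assms(1,2) this, of \<beta> "q powr (\<beta> + 1)"]
  have c: "q powr \<beta> * (q * q ^ i) \<le> q powr (\<beta> + 1)" "q powr (\<beta> + 1) < 1"
    using durrmeyer_node_bounds[OF assms] durrmeyer_node_shift[OF assms(1)] by simp_all
  show "0 < durrmeyer_weight q \<alpha> \<beta> i"
    unfolding durrmeyer_weight_def using b(1)[OF c] assms by simp
  show "durrmeyer_weight q \<alpha> \<beta> i \<le> q ^ i * (q ^ i) powr \<alpha> * (1 / (\<Prod>j. 1 - q ^ j * q powr (\<beta> + 1)))"
    unfolding durrmeyer_weight_def using b(2)[OF c] assms by (intro mult_left_mono) auto
qed

text \<open>
  Near the origin the terms are dominated by a multiple of \<open>q\<^bsup>(1 + \<alpha> - \<gamma>) i\<^esup>\<close>, whose series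
  converges because condition C demands \<open>\<alpha> > \<gamma> - 1\<close>.
\<close>

lemma summable_weighted_values:
  assumes q: "0 < q" "q < 1" and \<beta>: "\<beta> > -1" and "condition_C \<alpha> f"
  shows "summable (\<lambda>i. \<bar>durrmeyer_weight q \<alpha> \<beta> i * f (durrmeyer_node q \<beta> i)\<bar>)"
proof -
  obtain \<gamma> A where \<gamma>: "\<gamma> \<ge> 0" "\<alpha> > \<gamma> - 1" "0 < A" "A \<le> 1"
    and bdd: "bounded ((\<lambda>x. x powr \<gamma> * f x) ` ({0<..A} \<inter> {0<..<1}))"
    using assms(4) unfolding condition_C_def by blast
  obtain K where "\<forall>x\<in>{0<..A} \<inter> {0<..<1}. \<bar>x powr \<gamma> * f x\<bar> \<le> K"
    using bdd unfolding bounded_iff by auto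
  then have K: "\<bar>x powr \<gamma> * f x\<bar> \<le> K" if "0 < x" "x \<le> A" "x < 1" for x
    using that by simp
  define Q where "Q = q powr (\<beta> + 1)"
  define B where "B = 1 / (\<Prod>j. 1 - q ^ j * Q)"
  define r where "r = q powr (1 + \<alpha> - \<gamma>)"
  have Q: "0 < Q" "Q < 1" using q durrmeyer_node_bounds[OF q \<beta>] by (simp_all add: Q_def)
  have B: "0 < B" using q_pochhammer_pos[of q Q] Q q by (simp add: B_def)
  have r: "0 < r" "r < 1" using q \<gamma> by (simp_all add: r_def powr01_less_one)
  have "(\<lambda>i. durrmeyer_node q \<beta> i) \<longlonglongrightarrow> 0"
    unfolding durrmeyer_node_def using q by (auto intro!: tendsto_mult_right_zero LIMSEQ_realpow_zero)
  then have "\<forall>\<^sub>F i in sequentially. durrmeyer_node q \<beta> i < A"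
    using \<gamma>(3) by (rule order_tendstoD)
  then have "\<forall>\<^sub>F i in sequentially.
      norm \<bar>durrmeyer_weight q \<alpha> \<beta> i * f (durrmeyer_node q \<beta> i)\<bar> \<le> B * K * Q powr (- \<gamma>) * r ^ i"
  proof eventually_elim
    case (elim i)
    let ?y = "durrmeyer_node q \<beta> i"
    have y: "0 < ?y" "?y < 1" using durrmeyer_node_bounds[OF q \<beta>] by auto
    have "?y powr \<gamma> * \<bar>f ?y\<bar> \<le> K" using K[of ?y] y elim by (simp add: abs_mult)
    then have "?y powr (- \<gamma>) * (?y powr \<gamma> * \<bar>f ?y\<bar>) \<le> ?y powr (- \<gamma>) * K"
      by (intro mult_left_mono) auto
    then have f: "\<bar>f ?y\<bar> \<le> ?y powr (- \<gamma>) * K"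
      using y by (simp add: mult.assoc[symmetric] powr_add[symmetric])
    have "\<bar>durrmeyer_weight q \<alpha> \<beta> i\<bar> \<le> q ^ i * (q ^ i) powr \<alpha> * B"
      using durrmeyer_weight_bounds[OF q \<beta>, of \<alpha> i] unfolding B_def Q_def by simp
    then have "\<bar>durrmeyer_weight q \<alpha> \<beta> i * f ?y\<bar> \<le> (q ^ i * (q ^ i) powr \<alpha> * B) * (?y powr (- \<gamma>) * K)"
      unfolding abs_mult using f by (intro mult_mono) auto
    also have "?y powr (- \<gamma>) = Q powr (- \<gamma>) * (q ^ i) powr (- \<gamma>)"
      using q Q by (simp add: durrmeyer_node_def Q_def[symmetric] powr_mult)
    also have "(q ^ i * (q ^ i) powr \<alpha> * B) * (Q powr (- \<gamma>) * (q ^ i) powr (- \<gamma>) * K)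
        = B * K * Q powr (- \<gamma>) * (q ^ i * (q ^ i) powr \<alpha> * (q ^ i) powr (- \<gamma>))"
      by (simp only: mult_ac)
    also have "q ^ i * (q ^ i) powr \<alpha> * (q ^ i) powr (- \<gamma>) = (q ^ i) powr (1 + \<alpha> - \<gamma>)"
      using q by (simp add: powr_add powr_diff powr_minus divide_inverse)
    also have "\<dots> = r ^ i"
      using q by (simp add: r_def powr_realpow[symmetric] powr_powr mult.commute)
    finally show ?case by simp
  qed
  then show ?thesis
    by (rule summable_comparison_test_ev) (use r in \<open>simp add: summable_mult summable_geometric\<close>)
qed

lemma summable_moment:
  assumes q: "0 < q" "q < 1" and \<beta>: "\<beta> > -1" and "condition_C \<alpha> f"
  shows "summable (\<lambda>i. durrmeyer_weight q \<alpha> \<beta> i * f (durrmeyer_node q \<beta> i) *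
      q_kernel q n k (durrmeyer_node q \<beta> i))"
proof (rule summable_rabs_cancel, rule summable_mult_bounded[OF summable_weighted_values[OF assms]])
  fix i
  show "\<bar>q_kernel q n k (durrmeyer_node q \<beta> i)\<bar> \<le> 1"
    using q_kernel_bounds[of q "durrmeyer_node q \<beta> i" n k] q durrmeyer_node_bounds[OF q \<beta>] by simp
qed

text \<open>
  In terms of \<open>y = q\<^bsup>\<beta>+1\<^esup> t\<close>, the point at which \<open>f\<close> is evaluated, the integer \<open>n - k\<close> in the exponent
  splits off as \<open>(1 - q t)\<^sub>q\<^bsup>n-k+\<beta>\<^esup> = (1 - q t)\<^sub>q\<^sup>\<beta> (1 - y)\<^sub>q\<^bsup>n-k\<^esup>\<close>. Hence the kernel of the integral is again
  a q-Bernstein kernel, up to powers of \<open>q\<^bsup>\<beta>+1\<^esup>\<close>.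
\<close>

lemma jackson_integral_eq_moment:
  assumes q: "0 < q" "q < 1" and \<beta>: "\<beta> > -1" and "condition_C \<alpha> f"
  shows "jackson_integral q 1
       (\<lambda>t. t powr (real k + \<alpha>) * q_power q (q * t) (real (n - k) + \<beta>) * f (q powr (\<beta> + 1) * t))
     = (1 - q) / (q powr (\<beta> + 1)) ^ k *
       (\<Sum>i. durrmeyer_weight q \<alpha> \<beta> i * f (durrmeyer_node q \<beta> i) * q_kernel q n k (durrmeyer_node q \<beta> i))"
proof -
  let ?y = "durrmeyer_node q \<beta>" and ?w = "durrmeyer_weight q \<alpha> \<beta>"
  define Q where "Q = q powr (\<beta> + 1)"
  have Q: "0 < Q" using q by (simp add: Q_def)
  have summand: "q ^ i * ((q ^ i * 1) powr (real k + \<alpha>) * q_power q (q * (q ^ i * 1)) (real (n - k) + \<beta>) * f (Q * (q ^ i * 1)))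
       = 1 / Q ^ k * (?w i * f (?y i) * q_kernel q n k (?y i))" for i
  proof -
    have "q * q ^ i < 1" using q power_Suc_less_one[of q i] by simp
    then have "q_power q (q * q ^ i) (real (n - k) + \<beta>) = q_power q (q * q ^ i) \<beta> * (\<Prod>j<n - k. 1 - q ^ j * ?y i)"
      using q_power_add_nat[of q "q * q ^ i" \<beta> "n - k"] q durrmeyer_node_bounds[OF q \<beta>] durrmeyer_node_shift[OF q(1), of \<beta> i]
      by simp
    moreover have "?y i ^ k / Q ^ k = (q ^ i) ^ k"
      using Q by (simp add: durrmeyer_node_def flip: Q_def power_divide)
    then have "(q ^ i) powr (real k + \<alpha>) = (q ^ i) powr \<alpha> * (?y i ^ k / Q ^ k)"
      using q by (simp add: powr_add powr_realpow)
    ultimately show ?thesis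
      by (simp add: durrmeyer_weight_def q_kernel_def durrmeyer_node_def Q_def)
  qed
  show ?thesis
    unfolding jackson_integral_def Q_def[symmetric] summand suminf_mult[OF summable_moment[OF assms]] by simp
qed

text \<open>
  The normalising integral is the numerator for the constant function 1, which satisfies condition C
  because \<open>\<alpha> > -1\<close>; it is therefore a convergent sum of positive terms.
\<close>

lemma sgn_q_durrmeyer_coeff:
  assumes q: "0 < q" "q < 1" and \<alpha>: "\<alpha> > -1" and \<beta>: "\<beta> > -1" and "condition_C \<alpha> f"
  shows "sgn (q_durrmeyer_coeff q \<alpha> \<beta> n k f) = sgn (\<Sum>i. durrmeyer_weight q \<alpha> \<beta> i *
      f (durrmeyer_node q \<beta> i) * q_kernel q n k (durrmeyer_node q \<beta> i))"
proof -
  let ?y = "durrmeyer_node q \<beta>" and ?w = "durrmeyer_weight q \<alpha> \<beta>"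
  have "bounded ((\<lambda>x::real. x powr 0 * 1) ` ({0<..1} \<inter> {0<..<1}))"
    by (rule boundedI[of _ 1]) auto
  then have one: "condition_C \<alpha> (\<lambda>_. 1)"
    unfolding condition_C_def using \<alpha> by (intro exI[of _ 0] exI[of _ 1]) simp
  have ker: "0 < q_kernel q n k (?y i)" for i
    using q_kernel_bounds[of q "?y i" n k] q durrmeyer_node_bounds[OF q \<beta>] by simp
  have "0 < (\<Sum>i. ?w i * 1 * q_kernel q n k (?y i))"
    using summable_moment[OF q \<beta> one]
    by (rule suminf_pos) (use ker durrmeyer_weight_bounds[OF q \<beta>] in simp)
  then have "0 < jackson_integral q 1 (\<lambda>t. t powr (real k + \<alpha>) * q_power q (q * t) (real (n - k) + \<beta>))"
    using jackson_integral_eq_moment[OF q \<beta> one, of k n] q by simp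
  then show ?thesis
    unfolding q_durrmeyer_coeff_def jackson_integral_eq_moment[OF q \<beta> assms(5)]
    using q by (simp add: sgn_mult sgn_divide)
qed

theorem corollary1:
  fixes q \<alpha> \<beta> :: real and n :: nat and f :: "real \<Rightarrow> real"
  assumes "0 < q" and "q < 1"
    and "\<alpha> > -1" and "\<beta> > -1"
    and "condition_C \<alpha> f"
  shows "sign_changes (q_durrmeyer q \<alpha> \<beta> n f) \<le> sign_changes f"
proof (rule sign_changes_le_if_alternates)
  fix m
  let ?y = "durrmeyer_node q \<beta>" and ?w = "durrmeyer_weight q \<alpha> \<beta>"
  let ?c = "\<lambda>k. q_durrmeyer_coeff q \<alpha> \<beta> n k f"
  let ?v = "\<lambda>i. ?w i * f (?y i)"
  note q = assms(1,2) and y = durrmeyer_node_bounds[OF assms(1,2,4)]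
  assume alt: "alternates (q_durrmeyer q \<alpha> \<beta> n f) {0<..<1} m"
  have expand: "q_durrmeyer q \<alpha> \<beta> n f x = (\<Sum>k\<le>n. ?c k * q_binomial q n k * q_kernel q n k x)"
    if "x \<in> {0<..<1}" for x
    using that q by (simp add: q_durrmeyer_def q_bernstein_eq_kernel atLeast0AtMost mult.assoc)
  have "alternates (\<lambda>x. \<Sum>k\<le>n. ?c k * q_binomial q n k * q_kernel q n k x) {0<..<1} m"
    by (rule alternates_sgn_cong[OF alt]) (simp add: expand)
  then have coeff: "alternates (\<lambda>k. ?c k * q_binomial q n k) {..n} m"
    by (rule alternates_coefficients[OF q])
  have sgn_coeff: "sgn (?c k * q_binomial q n k) = sgn (\<Sum>i. ?v i * q_kernel q n k (?y i))" for k
    using sgn_q_durrmeyer_coeff[OF assms] q_binomial_pos[OF q] by (simp add: sgn_mult)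
  have "alternates (\<lambda>k. \<Sum>i. ?v i * q_kernel q n k (?y i)) {..n} m"
    by (rule alternates_sgn_cong[OF coeff sgn_coeff])
  then have weighted: "alternates ?v UNIV m"
    by (rule alternates_moments[where y = ?y and v = ?v, OF q y(1-3) summable_weighted_values[OF assms(1,2,4,5)]])
  have sgn_v: "sgn (?v i) = sgn (f (?y i))" for i
    using durrmeyer_weight_bounds(1)[OF assms(1,2,4)] by (simp add: sgn_mult)
  have "alternates (\<lambda>i. f (?y i)) UNIV m"
    by (rule alternates_sgn_cong[OF weighted sgn_v])
  then obtain t \<sigma> where t: "alternating_at (\<lambda>i. f (?y i)) t \<sigma> m" unfolding alternates_def by blast
  have anti: "?y j < ?y i" if "i < j" for i j
    using that y(3) by (induction j) (auto simp: less_Suc_eq intro: less_trans)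
  \<comment> \<open>The nodes decrease, so an alternation in the index becomes one in (0,1) when read backwards;
    the leading sign then is that of the former last term.\<close>
  have "alternating_at f (\<lambda>i. ?y (t (m - i))) (\<sigma> * (-1) ^ m) m"
    unfolding alternating_at_def
  proof (intro conjI allI impI)
    fix i assume "i < m"
    then show "?y (t (m - i)) < ?y (t (m - Suc i))"
      using alternating_at_mono[OF t, of "m - Suc i" "m - i"] by (intro anti) simp
  next
    fix i assume "i \<le> m"
    then have "\<sigma> * (-1) ^ m * (-1) ^ i = \<sigma> * (-1) ^ (m - i)"
      by (simp add: minus_one_power_iff)
    moreover have "0 < \<sigma> * (-1) ^ (m - i) * f (?y (t (m - i)))"
      using t by (simp add: alternating_at_def)
    ultimately show "0 < \<sigma> * (-1) ^ m * (-1) ^ i * f (?y (t (m - i)))" by (simp only:)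
  qed
  then show "alternates f {0<..<1} m"
    unfolding alternates_def using y(1,2)
    by (intro exI[of _ "\<lambda>i. ?y (t (m - i))"] exI[of _ "\<sigma> * (-1) ^ m"]) auto
qed

end
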